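(* Let $n\geq 1$ and let $A\subset\mathbb{C}^n$ be a nonpolar (i.e. not pluripolar), L-regular and polynomially convex compact set. Suppose that the pluricomplex Green function $G_A$ is pluriharmonic on $\mathbb{C}^n\setminus A$ (harmonic if $n=1$). Then there exists $c_0>0$ such that for every $c\in\,]0,c_0]$, the boundary $\partial A$ is included in the boundary of the open set $$\{z\in\mathbb{C}^n: G_A(z)>c\cdot dist(z,A)^{1/c}\}.$$
   Context: $dist$ denotes the Euclidean distance. For a compact set $A\subset\mathbb{C}^n$, the pluricomplex Green function of $A$ is $$G_A:={\sup}^*\Big\{v\in PSH(\mathbb{C}^n): v|_A\leq 0,\ v(z)\leq \tfrac12\log(1+\|z\|^2)+O(1)\Big\},$$ where $PSH(\mathbb{C}^n)$ is the set of plurisubharmonic functions on $\mathbb{C}^n$ and ${\sup}^*$ denotes the upper semicontinuous regularization of the upper envelope. The set $A$ is called L-regular if $G_A$ is continuous. $A$ is polynomially convex if it equals its polynomially convex envelope $\hat A$. A continuous function $u$ from an open set of $\mathbb{C}^n$ into $\mathbb{R}$ is pluriharmonic (harmonic if $n=1$) if and only if $\partial\overline{\partial}u=0$ in the sense of currents.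
   Formalization: L-regular is taken to mean that G_A is continuous and also vanishes on A; with continuity of the regularized G_A alone the claim fails, e.g. for a closed disc together with an isolated point outside it. *)

theory Defs
  imports "HOL-Analysis.Analysis"
begin

text \<open>
  The space \<open>\<complex>\<^sup>n\<close> is \<open>complex ^ 'n\<close>, whose \<^const>\<open>norm\<close> is the Euclidean one.
  Plurisubharmonic functions take values in \<open>[-\<infinity>, \<infinity>)\<close>, so they are \<^typ>\<open>ereal\<close>-valued.
\<close>

definition upper_semicontinuous :: "('a::topological_space \<Rightarrow> ereal) \<Rightarrow> bool" where
  "upper_semicontinuous u \<longleftrightarrow> (\<forall>c. open {z. u z < c})"

text \<open>
  The mean value \<open>1/(2\<pi>) \<integral>\<^sub>0\<^sup>2\<^sup>\<pi> u(a + e\<^sup>i\<^sup>t b) dt\<close>, with the integral taken as that of the positive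
  part minus that of the negative part (\<^const>\<open>e2ennreal\<close> truncates at 0). If \<open>u\<close> is upper
  semicontinuous and \<open>< \<infinity>\<close>, it is bounded above on the circle, so the first of these is finite
  and the difference is meaningful, possibly \<open>-\<infinity>\<close>.
\<close>

definition circle_mean :: "(complex ^ 'n \<Rightarrow> ereal) \<Rightarrow> complex ^ 'n \<Rightarrow> complex ^ 'n \<Rightarrow> ereal" where
  "circle_mean u a b = ereal (1 / (2 * pi)) *
     (enn2ereal (\<integral>\<^sup>+ t\<in>{0..2 * pi}. e2ennreal (u (a + cis t *s b)) \<partial>lborel)
      - enn2ereal (\<integral>\<^sup>+ t\<in>{0..2 * pi}. e2ennreal (- u (a + cis t *s b)) \<partial>lborel))"

text \<open>The constant \<open>-\<infinity>\<close> is not counted as plurisubharmonic.\<close>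

definition plurisubharmonic :: "(complex ^ 'n::finite \<Rightarrow> ereal) \<Rightarrow> bool" where
  "plurisubharmonic u \<longleftrightarrow>
     upper_semicontinuous u \<and> (\<forall>z. u z < \<infinity>) \<and> (\<exists>z. u z \<noteq> -\<infinity>) \<and>
     (\<forall>a b. u a \<le> circle_mean u a b)"

definition pluripolar :: "(complex ^ 'n::finite) set \<Rightarrow> bool" where
  "pluripolar A \<longleftrightarrow> (\<exists>u. plurisubharmonic u \<and> A \<subseteq> {z. u z = -\<infinity>})"

definition green_competitors :: "(complex ^ 'n::finite) set \<Rightarrow> (complex ^ 'n \<Rightarrow> ereal) set" where
  "green_competitors A =
     {v. plurisubharmonic v \<and> (\<forall>z\<in>A. v z \<le> 0) \<and>
         (\<exists>C::real. \<forall>z. v z \<le> ereal (1 / 2 * ln (1 + (norm z)\<^sup>2) + C))}"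

definition usc_regularization :: "('a::topological_space \<Rightarrow> ereal) \<Rightarrow> 'a \<Rightarrow> ereal" where
  "usc_regularization u z = Limsup (nhds z) u"

definition green :: "(complex ^ 'n::finite) set \<Rightarrow> complex ^ 'n \<Rightarrow> ereal" where
  "green A = usc_regularization (\<lambda>z. SUP v\<in>green_competitors A. v z)"

text \<open>
  L-regularity in the sense of Siciak: the regularization does not destroy the condition \<open>\<le> 0\<close>
  on \<open>A\<close>. Continuity of \<^term>\<open>green A\<close> alone does not detect failure of this on a pluripolar part
  of \<open>A\<close>: for a closed disc together with an isolated point \<open>p\<close>, \<^term>\<open>green A\<close> is the Green
  function of the disc, which is continuous but positive at \<open>p\<close>.
\<close>

definition L_regular :: "(complex ^ 'n::finite) set \<Rightarrow> bool" where
  "L_regular A \<longleftrightarrow> continuous_on UNIV (green A) \<and> (\<forall>z\<in>A. green A z = 0)"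

definition complex_polynomial :: "(complex ^ 'n::finite \<Rightarrow> complex) \<Rightarrow> bool" where
  "complex_polynomial p \<longleftrightarrow>
     (\<exists>(S::('n \<Rightarrow> nat) set) c. finite S \<and> p = (\<lambda>z. \<Sum>\<alpha>\<in>S. c \<alpha> * (\<Prod>i\<in>UNIV. z $ i ^ \<alpha> i)))"

definition polynomial_hull :: "(complex ^ 'n::finite) set \<Rightarrow> (complex ^ 'n) set" where
  "polynomial_hull A =
     {z. \<forall>p. complex_polynomial p \<longrightarrow> ereal (norm (p z)) \<le> (SUP w\<in>A. ereal (norm (p w)))}"

definition polynomially_convex :: "(complex ^ 'n::finite) set \<Rightarrow> bool" where
  "polynomially_convex A \<longleftrightarrow> A = polynomial_hull A"

primrec C_diff :: "nat \<Rightarrow> ('a::real_normed_vector \<Rightarrow> 'b::real_normed_vector) \<Rightarrow> bool" where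
  "C_diff 0 f \<longleftrightarrow> continuous_on UNIV f"
| "C_diff (Suc k) f \<longleftrightarrow>
     (\<forall>x. f differentiable at x) \<and> (\<forall>v. C_diff k (\<lambda>x. frechet_derivative f (at x) v))"

definition test_functions :: "(complex ^ 'n::finite) set \<Rightarrow> (complex ^ 'n \<Rightarrow> complex) set" where
  "test_functions \<Omega> =
     {\<phi>. (\<forall>k. C_diff k \<phi>) \<and> compact (closure {z. \<phi> z \<noteq> 0}) \<and> closure {z. \<phi> z \<noteq> 0} \<subseteq> \<Omega>}"

definition wirt :: "'n \<Rightarrow> (complex ^ 'n::finite \<Rightarrow> complex) \<Rightarrow> complex ^ 'n \<Rightarrow> complex" where
  "wirt j f z = (frechet_derivative f (at z) (axis j 1)
                 - \<i> * frechet_derivative f (at z) (axis j \<i>)) / 2"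

definition wirt_bar :: "'n \<Rightarrow> (complex ^ 'n::finite \<Rightarrow> complex) \<Rightarrow> complex ^ 'n \<Rightarrow> complex" where
  "wirt_bar j f z = (frechet_derivative f (at z) (axis j 1)
                     + \<i> * frechet_derivative f (at z) (axis j \<i>)) / 2"

text \<open>
  \<open>d d-bar u = 0\<close> in the sense of currents, for continuous \<open>u\<close>. The coefficient of
  \<open>dz\<^sub>j \<and> d(z-bar)\<^sub>k\<close> in this current is the distribution sending \<open>\<phi>\<close> to the integral of
  \<open>u\<close> times \<open>wirt j (wirt_bar k \<phi>)\<close> (two integrations by parts, hence no sign), and the current is
  zero when all its coefficients are.
\<close>

definition pluriharmonic_on :: "(complex ^ 'n::finite) set \<Rightarrow> (complex ^ 'n \<Rightarrow> real) \<Rightarrow> bool" where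
  "pluriharmonic_on \<Omega> u \<longleftrightarrow>
     open \<Omega> \<and> continuous_on \<Omega> u \<and>
     (\<forall>\<phi>\<in>test_functions \<Omega>. \<forall>j k.
        (LINT z:\<Omega>|lborel. complex_of_real (u z) * wirt j (wirt_bar k \<phi>) z) = 0)"

end

theory Submission
  imports Defs
begin

text \<open>
  On \<open>A\<close> both the Green function \<open>G\<close> and the distance vanish, so no point of \<open>A\<close> lies in the open set of the
  theorem, and the claim is that this set accumulates at every boundary point \<open>a\<close>. Suppose that it does
  not: then \<open>G \<le> c dist (z, A)\<^bsup>1/c\<^esup>\<close> near \<open>a\<close>. Choose \<open>p \<notin> A\<close> close to \<open>a\<close> and a nearest point \<open>q \<in> A\<close> of \<open>p\<close>. The
  open ball about \<open>p\<close> of radius \<open>\<parallel>p - q\<parallel>\<close> lies off \<open>A\<close>; on it \<open>G\<close> is pluriharmonic and positive, and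
  \<open>G (z) \<le> c \<parallel>z - q\<parallel>\<^bsup>1/c\<^esup>\<close>. As in the Hopf lemma, a positive harmonic function on a ball cannot vanish to high
  order at a boundary point, which is a contradiction once \<open>1/c\<close> is large compared with a number that
  depends only on \<open>n\<close>.

  The bound on the order of vanishing (\<open>pluriharmonic_not_flat_at_boundary_point\<close>) is obtained directly
  from the distributional definition. A single family of test functions, steep bumps
  whose Laplacian is negative only near the centre, yields a doubling inequality for the integrals of
  \<open>G\<close> over concentric balls (\<open>pluriharmonic_doubling\<close>); it is iterated along the segment from \<open>p\<close> to \<open>q\<close>.

  Positivity of \<open>G\<close> off \<open>A\<close> is where polynomial convexity enters
  (\<open>green_pos_outside_polynomial_hull\<close>): a polynomial \<open>f\<close> with \<open>\<bar>f\<bar> \<le> M\<close> on \<open>A\<close> and \<open>\<bar>f\<bar> > M\<close> at a given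
  point gives, for large \<open>d\<close>, the competitor \<open>(ln (1 + \<bar>f\<bar>\<^sup>2) - ln (1 + M\<^sup>2)) / (2 d)\<close>; its plurisubharmonicity
  follows from the convexity of its means over concentric circles in the logarithm of the radius.
\<close>

section \<open>Smooth radial bumps\<close>

text \<open>
  The functions \<open>t\<^sup>-\<^sup>k exp (- l / t)\<close>, extended by \<open>0\<close> to \<open>t \<le> 0\<close>. The case \<open>k = 0\<close> gives the bump; the
  other exponents are there because they make the family closed, up to linear combinations, under
  differentiation.
\<close>

definition flat :: "real \<Rightarrow> nat \<Rightarrow> real \<Rightarrow> real" where
  "flat l k t = (if t > 0 then exp (- l / t) / t ^ k else 0)"

text \<open>
  Quadratic decay at the origin is what makes the two halves fit together differentiably there;
  it follows from comparing \<open>exp (l / t)\<close> with a single term of its series.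
\<close>

lemma flat_le_square:
  assumes "l > 0"
  shows "\<exists>C. \<forall>t. \<bar>flat l k t\<bar> \<le> C * t\<^sup>2"
proof -
  have "\<bar>flat l k t\<bar> \<le> fact (k+2) / l ^ (k+2) * t\<^sup>2" for t
  proof (cases "t > 0")
    case True
    define x where "x = l / t"
    have x: "x > 0" "t = l / x" using True assms by (auto simp: x_def)
    have "x ^ (k+2) / fact (k+2) \<le> exp x"
    proof -
      have "(\<Sum>n\<in>{k+2}. x ^ n /\<^sub>R fact n) \<le> (\<Sum>n. x ^ n /\<^sub>R fact n)"
        by (rule sum_le_suminf) (use x in \<open>auto intro: summable_exp_generic intro!: scaleR_nonneg_nonneg simp del: real_scaleR_def\<close>)
      then show ?thesis by (simp add: exp_def divide_inverse mult.commute del: power_Suc fact_Suc)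
    qed
    then have "exp (-x) \<le> fact (k+2) / x ^ (k+2)"
      using x by (simp add: exp_minus field_simps del: power_Suc fact_Suc)
    then have "exp (-x) / t ^ k \<le> fact (k+2) / x ^ (k+2) / t ^ k"
      using True by (intro divide_right_mono) auto
    also have "\<dots> = fact (k+2) / l ^ (k+2) * t\<^sup>2"
      using True assms by (simp add: x_def power_add power2_eq_square power_divide field_simps del: fact_Suc)
    finally show ?thesis using True by (simp add: flat_def x_def)
  qed (use assms in \<open>auto simp: flat_def\<close>)
  then show ?thesis by blast
qed

lemma flat_has_derivative:
  assumes "l > 0"
  shows "(flat l k has_real_derivative l * flat l (k+2) t - k * flat l (k+1) t) (at t)"
proof -
  consider "t > 0" | "t < 0" | "t = 0" by linarith
  then show ?thesis
  proof cases
    case 1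
    have "((\<lambda>t. exp (- l / t) / t ^ k) has_real_derivative l * flat l (k+2) t - k * flat l (k+1) t) (at t)"
    proof -
      have k: "real k * t ^ (k - Suc 0) = real k * t ^ k / t" using 1 by (cases k) auto
      have "((\<lambda>t. exp (- l / t) / t ^ k) has_real_derivative
          (l / t\<^sup>2 * exp (- l / t) * t ^ k - exp (- l / t) * (real k * t ^ (k - Suc 0))) / (t ^ k * t ^ k)) (at t)"
        using 1 by (auto intro!: derivative_eq_intros simp: field_simps power2_eq_square)
      moreover have "(l / t\<^sup>2 * exp (- l / t) * t ^ k - exp (- l / t) * (real k * t ^ (k - Suc 0))) / (t ^ k * t ^ k)
          = l * flat l (k+2) t - k * flat l (k+1) t"
        unfolding k using 1 by (simp add: flat_def field_simps power2_eq_square power_add)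
      ultimately show ?thesis by metis
    qed
    then show ?thesis
      by (rule has_field_derivative_transform_within_open[where S="{0<..}"]) (use 1 in \<open>auto simp: flat_def\<close>)
  next
    case 2
    have "((\<lambda>t. 0) has_real_derivative l * flat l (k+2) t - k * flat l (k+1) t) (at t)"
      using 2 by (auto simp: flat_def)
    then show ?thesis
      by (rule has_field_derivative_transform_within_open[where S="{..<0}"]) (use 2 in \<open>auto simp: flat_def\<close>)
  next
    case 3
    obtain C where C: "\<And>t. \<bar>flat l k t\<bar> \<le> C * t\<^sup>2" using flat_le_square[OF assms] by blast
    have "((\<lambda>h. flat l k h / h) \<longlongrightarrow> 0) (at 0)"
    proof (rule Lim_null_comparison)
      show "\<forall>\<^sub>F h in at 0. norm (flat l k h / h) \<le> C * \<bar>h\<bar>"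
      proof (rule always_eventually, rule allI)
        fix h :: real show "norm (flat l k h / h) \<le> C * \<bar>h\<bar>"
          using C[of h] by (cases "h = 0") (auto simp: field_simps power2_eq_square abs_mult)
      qed
      show "((\<lambda>h. C * \<bar>h\<bar>) \<longlongrightarrow> 0) (at 0)"
        by (auto intro!: tendsto_eq_intros)
    qed
    then have "(flat l k has_real_derivative 0) (at 0)"
      by (simp add: has_field_derivative_iff flat_def)
    then show ?thesis using 3 by (simp add: flat_def)
  qed
qed

text \<open>
  The algebra generated by the constants, the linear coordinates and the radial functions
  \<open>flat l k (s\<^sup>2 - \<parallel>y - x\<parallel>\<^sup>2)\<close>. It is stable under directional derivatives, so each of its members has
  derivatives of all orders; this replaces any computation of higher derivatives of the bump.
\<close>

inductive bump_algebra :: "(complex ^ 'n::finite) \<Rightarrow> real \<Rightarrow> real \<Rightarrow> (complex ^ 'n \<Rightarrow> complex) \<Rightarrow> bool"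
  for x :: "complex ^ 'n" and s l :: real where
  const: "bump_algebra x s l (\<lambda>y. c)"
| coord: "bump_algebra x s l (\<lambda>y. of_real ((y - x) \<bullet> v))"
| flat: "bump_algebra x s l (\<lambda>y. of_real (flat l k (s\<^sup>2 - (norm (y - x))\<^sup>2)))"
| add: "bump_algebra x s l f \<Longrightarrow> bump_algebra x s l g \<Longrightarrow> bump_algebra x s l (\<lambda>y. f y + g y)"
| mult: "bump_algebra x s l f \<Longrightarrow> bump_algebra x s l g \<Longrightarrow> bump_algebra x s l (\<lambda>y. f y * g y)"

lemma flat_comp_has_derivative:
  fixes x :: "'a::real_inner"
  assumes "l > 0"
  shows "((\<lambda>y. flat l k (s\<^sup>2 - (norm (y - x))\<^sup>2)) has_derivative
           (\<lambda>v. (l * flat l (k+2) (s\<^sup>2 - (norm (y - x))\<^sup>2) - k * flat l (k+1) (s\<^sup>2 - (norm (y - x))\<^sup>2))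
              * (- 2 * ((y - x) \<bullet> v)))) (at y)"
proof -
  have 1: "((\<lambda>y. s\<^sup>2 - (norm (y - x))\<^sup>2) has_derivative (\<lambda>v. - 2 * ((y - x) \<bullet> v))) (at y)"
    unfolding power2_norm_eq_inner
    by (auto intro!: derivative_eq_intros simp: inner_commute)
  show ?thesis
    using has_derivative_compose[OF 1 flat_has_derivative[OF assms, of k, unfolded has_field_derivative_def]]
    by simp
qed

lemma bump_algebra_derivative:
  assumes "bump_algebra x s l f" "l > 0"
  shows "\<exists>D. \<forall>y. (f has_derivative D y) (at y) \<and> (\<forall>v. bump_algebra x s l (\<lambda>y. D y v))"
  using assms(1)
proof induction
  case (const c)
  show ?case by (rule exI[of _ "\<lambda>y v. 0"]) (auto intro: bump_algebra.const)
next
  case (coord v)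
  show ?case
    by (rule exI[of _ "\<lambda>y w. of_real (w \<bullet> v)"])
      (auto intro!: bump_algebra.const derivative_eq_intros)
next
  case (flat k)
  have "bump_algebra x s l (\<lambda>y. (of_real l * of_real (flat l (k+2) (s\<^sup>2 - (norm (y - x))\<^sup>2)) +
       (- of_nat k) * of_real (flat l (k+1) (s\<^sup>2 - (norm (y - x))\<^sup>2))) * (of_real (-2) * of_real ((y - x) \<bullet> v)))" for v
    by (intro bump_algebra.intros)
  then show ?case
    using flat_comp_has_derivative[OF assms(2), of k s x]
    by (intro exI[of _ "\<lambda>y v. of_real ((l * flat l (k+2) (s\<^sup>2 - (norm (y - x))\<^sup>2) - k * flat l (k+1) (s\<^sup>2 - (norm (y - x))\<^sup>2))
              * (- 2 * ((y - x) \<bullet> v)))"] allI conjI has_derivative_of_real) simp_all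
next
  case (add f g)
  then obtain D E where D: "\<And>y. (f has_derivative D y) (at y)" "\<And>v. bump_algebra x s l (\<lambda>y. D y v)"
    and E: "\<And>y. (g has_derivative E y) (at y)" "\<And>v. bump_algebra x s l (\<lambda>y. E y v)" by metis
  show ?case
    by (rule exI[of _ "\<lambda>y v. D y v + E y v"]) (auto intro!: bump_algebra.intros has_derivative_add D E)
next
  case (mult f g)
  then obtain D E where D: "\<And>y. (f has_derivative D y) (at y)" "\<And>v. bump_algebra x s l (\<lambda>y. D y v)"
    and E: "\<And>y. (g has_derivative E y) (at y)" "\<And>v. bump_algebra x s l (\<lambda>y. E y v)" by metis
  show ?case
    by (rule exI[of _ "\<lambda>y v. f y * E y v + D y v * g y"])
      (auto intro!: bump_algebra.intros has_derivative_mult mult.hyps D E)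
qed

lemma bump_algebra_C_diff:
  assumes "bump_algebra x s l f" "l > 0"
  shows "C_diff k f"
  using assms(1)
proof (induction k arbitrary: f)
  case 0
  then obtain D where "\<And>y. (f has_derivative D y) (at y)" using bump_algebra_derivative[OF _ assms(2)] by metis
  then show ?case by (auto simp: continuous_on_eq_continuous_at intro: has_derivative_continuous)
next
  case (Suc k)
  then obtain D where D: "\<And>y. (f has_derivative D y) (at y)" "\<And>v. bump_algebra x s l (\<lambda>y. D y v)"
    using bump_algebra_derivative[OF _ assms(2)] by metis
  have "frechet_derivative f (at y) = D y" for y
    using D(1)[of y] by (metis frechet_derivative_at)
  then show ?case using D Suc.IH by (auto simp: differentiable_def)
qed

lemma inner_axis_1_and_i:
  fixes w :: "complex ^ 'n::finite"
  shows "w \<bullet> axis j 1 = Re (w $ j)" "w \<bullet> axis j \<i> = Im (w $ j)"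
  by (simp_all add: inner_axis inner_complex_def)

definition bump :: "real \<Rightarrow> (complex ^ 'n::finite) \<Rightarrow> real \<Rightarrow> complex ^ 'n \<Rightarrow> complex" where
  "bump l x s y = of_real (flat l 0 (s\<^sup>2 - (norm (y - x))\<^sup>2))"

lemma bump_test_function:
  fixes x :: "complex ^ 'n::finite"
  assumes "l > 0" "s > 0" "cball x s \<subseteq> \<Omega>"
  shows "bump l x s \<in> test_functions \<Omega>"
proof -
  have "{y. bump l x s y \<noteq> 0} \<subseteq> cball x s"
  proof clarsimp
    fix y assume "bump l x s y \<noteq> 0"
    then have "(norm (y - x))\<^sup>2 < s\<^sup>2" by (auto simp: bump_def flat_def split: if_splits)
    then show "dist x y \<le> s" using assms(2) 
      using power2_less_imp_less[of "norm (y - x)" s] assms(2) by (simp add: dist_norm norm_minus_commute)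
  qed
  then have c: "closure {y. bump l x s y \<noteq> 0} \<subseteq> cball x s"
    by (rule closure_minimal) simp
  then have "bounded (closure {y. bump l x s y \<noteq> 0})"
    by (rule bounded_subset[rotated]) simp
  then have "compact (closure {y. bump l x s y \<noteq> 0})" by (simp add: compact_eq_bounded_closed)
  moreover have "C_diff k (bump l x s)" for k
    by (rule bump_algebra_C_diff[OF _ assms(1)]) (unfold bump_def[abs_def], rule bump_algebra.flat)
  ultimately show ?thesis using c assms(3) by (auto simp: test_functions_def)
qed

lemma wirt_bar_bump:
  assumes "l > 0"
  shows "wirt_bar j (bump l x s) = (\<lambda>y. - of_real (l * flat l 2 (s\<^sup>2 - (norm (y - x))\<^sup>2)) * (y - x) $ j)"
proof
  fix y
  have "(bump l x s has_derivative (\<lambda>v. of_real (l * flat l 2 (s\<^sup>2 - (norm (y - x))\<^sup>2) * (- 2 * ((y - x) \<bullet> v))))) (at y)"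
    using has_derivative_of_real[OF flat_comp_has_derivative[OF assms, of 0 s x y], where 'a=complex]
    by (simp add: bump_def[abs_def] numeral_2_eq_2)
  then have f: "frechet_derivative (bump l x s) (at y) = (\<lambda>v. of_real (l * flat l 2 (s\<^sup>2 - (norm (y - x))\<^sup>2) * (- 2 * ((y - x) \<bullet> v))))"
    by (metis frechet_derivative_at)
  show "wirt_bar j (bump l x s) y = - of_real (l * flat l 2 (s\<^sup>2 - (norm (y - x))\<^sup>2)) * (y - x) $ j"
    unfolding wirt_bar_def f inner_axis_1_and_i
    by (cases "(y - x) $ j") (simp add: complex_eq_iff algebra_simps del: vector_minus_component)
qed

text \<open>
  With \<open>w = y - x\<close>, \<open>\<partial>/\<partial>z-bar\<^sub>j\<close> of \<open>\<psi>(s\<^sup>2 - \<parallel>w\<parallel>\<^sup>2)\<close> is \<open>- \<psi>' w\<^sub>j\<close>, and a further \<open>\<partial>/\<partial>z\<^sub>j\<close> gives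
  \<open>\<psi>'' \<bar>w\<^sub>j\<bar>\<^sup>2 - \<psi>'\<close>. The two directions \<open>1\<close> and \<open>\<i>\<close> combine so that no inner product survives.
\<close>

lemma wirt_wirt_bar_bump:
  fixes x :: "complex ^ 'n::finite" and s :: real
  assumes "l > 0"
  defines "t \<equiv> \<lambda>y. s\<^sup>2 - (norm (y - x))\<^sup>2"
  shows "wirt j (wirt_bar j (bump l x s)) y = of_real (l *
      ((l * flat l 4 (t y) - 2 * flat l 3 (t y)) * (norm ((y - x) $ j))\<^sup>2 - flat l 2 (t y)))"
proof -
  define D where "D = l * flat l 4 (t y) - 2 * flat l 3 (t y)"
  have 1: "((\<lambda>y. complex_of_real (flat l 2 (t y))) has_derivative (\<lambda>v. of_real (D * (- 2 * ((y - x) \<bullet> v))))) (at y)"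
    using has_derivative_of_real[OF flat_comp_has_derivative[OF assms(1), of 2 s x y], where 'a=complex]
    by (simp add: t_def D_def)
  have 2: "((\<lambda>y. (y - x) $ j) has_derivative (\<lambda>v. v $ j)) (at y)"
    by (auto intro!: derivative_eq_intros bounded_linear.has_derivative[OF bounded_linear_vec_nth])
  have "((\<lambda>y. - of_real l * (of_real (flat l 2 (t y)) * (y - x) $ j)) has_derivative
      (\<lambda>v. - of_real l * (of_real (flat l 2 (t y)) * v $ j + of_real (D * (- 2 * ((y - x) \<bullet> v))) * (y - x) $ j))) (at y)"
    by (intro has_derivative_mult_right has_derivative_mult 1 2)
  then have f: "frechet_derivative (wirt_bar j (bump l x s)) (at y) =
      (\<lambda>v. - of_real l * (of_real (flat l 2 (t y)) * v $ j + of_real (D * (- 2 * ((y - x) \<bullet> v))) * (y - x) $ j))"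
    unfolding wirt_bar_bump[OF assms(1)] t_def
    by (subst frechet_derivative_at[symmetric]) (auto simp: mult.assoc)
  have n: "(norm z)\<^sup>2 = (Re z)\<^sup>2 + (Im z)\<^sup>2" for z by (simp add: cmod_power2)
  show ?thesis
    unfolding wirt_def f inner_axis_1_and_i D_def[symmetric] n
    by (simp add: complex_eq_iff field_simps power2_eq_square del: vector_minus_component)
qed

lemma sum_wirt_wirt_bar_bump:
  fixes x :: "complex ^ 'n::finite" and s :: real
  assumes "l > 0"
  defines "t \<equiv> \<lambda>y. s\<^sup>2 - (norm (y - x))\<^sup>2"
  shows "(\<Sum>j\<in>UNIV. wirt j (wirt_bar j (bump l x s)) y) = of_real (l *
      ((l * flat l 4 (t y) - 2 * flat l 3 (t y)) * (norm (y - x))\<^sup>2 - CARD('n) * flat l 2 (t y)))"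
proof -
  have n: "(norm (y - x))\<^sup>2 = (\<Sum>j\<in>UNIV. (norm ((y - x) $ j))\<^sup>2)"
    by (simp add: norm_vec_def L2_set_def sum_nonneg)
  show ?thesis
    unfolding wirt_wirt_bar_bump[OF  assms(1)]
    by (simp only: t_def n[symmetric] sum_distrib_left[symmetric] of_real_sum[symmetric] sum_subtractf sum_constant)
qed

section \<open>Doubling for nonnegative pluriharmonic functions\<close>

text \<open>
  A quarter of the Laplacian of the bump on \<open>\<real>\<^sup>2\<^sup>n = \<complex>\<^sup>n\<close>.
\<close>

definition bump_laplacian :: "real \<Rightarrow> (complex ^ 'n::finite) \<Rightarrow> real \<Rightarrow> complex ^ 'n \<Rightarrow> real" where
  "bump_laplacian l x s y = (let t = s\<^sup>2 - (norm (y - x))\<^sup>2 in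
     l * ((l * flat l 4 t - 2 * flat l 3 t) * (norm (y - x))\<^sup>2 - CARD('n) * flat l 2 t))"

text \<open>
  With \<open>r = (R / s)\<^sup>2 < 1\<close> and the exponent \<open>l = L s\<^sup>2\<close>, the scale \<open>s\<close> drops out and \<open>s\<^sup>2\<close> times the function
  equals \<open>L exp (- L / (1 - r)) (1 - r)\<^sup>-\<^sup>4 (r (L - 2 (1 - r)) - n (1 - r)\<^sup>2)\<close>. Hence a steep bump (large \<open>L\<close>)
  has a positive Laplacian away from its centre: \<open>L = 12 n + 14\<close> is chosen to make the last factor
  at least \<open>1\<close> as soon as \<open>r \<ge> 9/100\<close>.
\<close>

lemma bump_laplacian_bounds:
  fixes x y :: "complex ^ 'n::finite" and s L :: real
  defines "L \<equiv> 12 * real CARD('n) + 14" and "R \<equiv> norm (y - x)"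
  assumes s: "s > 0"
  shows bump_laplacian_nonneg: "3/10 * s \<le> R \<Longrightarrow> 0 \<le> s\<^sup>2 * bump_laplacian (L * s\<^sup>2) x s y"
    and bump_laplacian_ge: "3/10 * s \<le> R \<Longrightarrow> R \<le> 4/5 * s \<Longrightarrow>
          L * exp (- 3 * L) \<le> s\<^sup>2 * bump_laplacian (L * s\<^sup>2) x s y"
    and bump_laplacian_ge_centre: "R \<le> 3/10 * s \<Longrightarrow>
          - (2 * CARD('n) * L) \<le> s\<^sup>2 * bump_laplacian (L * s\<^sup>2) x s y"
    and bump_laplacian_outside: "s \<le> R \<Longrightarrow> bump_laplacian (L * s\<^sup>2) x s y = 0"
proof -
  define n where "n = real CARD('n)"
  have n: "n \<ge> 0" and L: "L = 12 * n + 14" by (auto simp: n_def L_def)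
  define r where "r = (R / s)\<^sup>2"
  have R: "R \<ge> 0" by (simp add: R_def)
  have R2: "R\<^sup>2 = r * s\<^sup>2" using s by (simp add: r_def power_divide)
  have r0: "r \<ge> 0" by (simp add: r_def)
  show out: "bump_laplacian (L * s\<^sup>2) x s y = 0" if "s \<le> R"
  proof -
    have "s\<^sup>2 \<le> R\<^sup>2" using that s by (intro power_mono) auto
    then show ?thesis by (simp add: bump_laplacian_def flat_def R_def)
  qed
  have small: "r < 1" if "R < s"
    unfolding r_def using that s R by (intro power_less_one_iff[THEN iffD2]) auto
  have formula: "s\<^sup>2 * bump_laplacian (L * s\<^sup>2) x s y =
      L * (exp (- L / (1 - r)) * (1 / (1 - r) ^ 4 * (r * (L - 2 * (1 - r)) - n * (1 - r)\<^sup>2)))" if "R < s"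
  proof -
    define w where "w = 1 - r"
    have w: "w > 0" using small[OF that] by (simp add: w_def)
    have t: "s\<^sup>2 - (norm (y - x))\<^sup>2 = s\<^sup>2 * w" unfolding R_def[symmetric] R2 by (simp add: w_def algebra_simps)
    have "- (L * s\<^sup>2) / (s\<^sup>2 * w) = - L / w" using s w by (simp add: field_simps)
    then have f: "flat (L * s\<^sup>2) k (s\<^sup>2 * w) = exp (- L / w) / (s\<^sup>2 * w) ^ k" for k
      using s w by (simp add: flat_def)
    have "s\<^sup>2 * bump_laplacian (L * s\<^sup>2) x s y =
      L * (exp (- L / w) * (1 / w ^ 4 * (r * (L - 2 * w) - n * w\<^sup>2)))"
      unfolding bump_laplacian_def Let_def t f unfolding R_def[symmetric] R2 n_def[symmetric]
      using s w by (simp add: field_simps eval_nat_numeral)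
    then show ?thesis by (simp add: w_def)
  qed
  have bracket: "r * (L - 2 * (1 - r)) - n * (1 - r)\<^sup>2 \<ge> 1" if "3/10 * s \<le> R" "R < s"
  proof -
    have "(3/10)\<^sup>2 \<le> r" unfolding r_def using that(1) s by (intro power_mono) (auto simp: field_simps)
    then have r: "9/100 \<le> r" by (simp add: power2_eq_square)
    have "9/100 * (12 * n + 12) \<le> r * (L - 2 * (1 - r))"
      using r n by (intro mult_mono) (auto simp: L)
    moreover have "n * (1 - r)\<^sup>2 \<le> n * 1"
      using small[OF that(2)] r0 n by (intro mult_left_mono power_le_one) auto
    ultimately have "9/100 * (12 * n + 12) - n * 1 \<le> r * (L - 2 * (1 - r)) - n * (1 - r)\<^sup>2"
      by (rule diff_mono)
    moreover have "1 \<le> 9/100 * (12 * n + 12) - n * 1" using n by (simp add: field_simps)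
    ultimately show ?thesis by linarith
  qed
  show "0 \<le> s\<^sup>2 * bump_laplacian (L * s\<^sup>2) x s y" if "3/10 * s \<le> R"
  proof (cases "R < s")
    case True
    show ?thesis unfolding formula[OF True]
      using bracket[OF that True] small[OF True] n by (intro mult_nonneg_nonneg) (auto simp: L)
  qed (use out in auto)
  show "L * exp (- 3 * L) \<le> s\<^sup>2 * bump_laplacian (L * s\<^sup>2) x s y" if A: "3/10 * s \<le> R" "R \<le> 4/5 * s"
  proof -
    have Rs: "R < s" using that s by simp
    have "r \<le> (4/5)\<^sup>2" unfolding r_def using that(2) s R by (intro power_mono) (auto simp: field_simps)
    then have r: "1 - r \<ge> 1/3" by (simp add: power2_eq_square)
    have "L / (1 - r) \<le> L / (1/3)" using r n by (intro divide_left_mono) (auto simp: L)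
    then have e: "exp (- 3 * L) \<le> exp (- L / (1 - r))" by simp
    have "(1 - r) ^ 4 \<le> 1" using r r0 by (intro power_le_one) auto
    then have p: "1 \<le> 1 / (1 - r) ^ 4" using r by (simp add: field_simps)
    have "1 * 1 \<le> 1 / (1 - r) ^ 4 * (r * (L - 2 * (1 - r)) - n * (1 - r)\<^sup>2)"
      using p bracket[OF A(1) Rs] by (intro mult_mono) auto
    then have "exp (- 3 * L) * 1 \<le> exp (- L / (1 - r)) * (1 / (1 - r) ^ 4 * (r * (L - 2 * (1 - r)) - n * (1 - r)\<^sup>2))"
      using e by (intro mult_mono) auto
    then have "L * (exp (- 3 * L) * 1) \<le> L * (exp (- L / (1 - r)) * (1 / (1 - r) ^ 4 * (r * (L - 2 * (1 - r)) - n * (1 - r)\<^sup>2)))"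
      using n by (intro mult_left_mono) (auto simp: L)
    then show ?thesis unfolding formula[OF Rs] by simp
  qed
  show "- (2 * CARD('n) * L) \<le> s\<^sup>2 * bump_laplacian (L * s\<^sup>2) x s y" if "R \<le> 3/10 * s"
  proof -
    have Rs: "R < s" using that s by simp
    have "r \<le> (3/10)\<^sup>2" unfolding r_def using that s R by (intro power_mono) (auto simp: field_simps)
    then have r: "1 - r \<ge> 91/100" by (simp add: power2_eq_square)
    have "(91/100) ^ 4 \<le> (1 - r) ^ 4" using r by (intro power_mono) auto
    then have "1/2 \<le> (1 - r) ^ 4" by (simp add: eval_nat_numeral)
    then have p: "1 / (1 - r) ^ 4 \<le> 2" using r by (simp add: field_simps)
    have e: "exp (- L / (1 - r)) \<le> 1" using r n by (simp add: L field_simps)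
    have "n * (1 - r)\<^sup>2 \<le> n * 1"
      using r r0 n by (intro mult_left_mono power_le_one) auto
    moreover have "0 \<le> r * (L - 2 * (1 - r))" using r r0 n by (intro mult_nonneg_nonneg) (auto simp: L)
    ultimately have b: "- n \<le> r * (L - 2 * (1 - r)) - n * (1 - r)\<^sup>2" by linarith
    have "exp (- L / (1 - r)) * (1 / (1 - r) ^ 4) * n \<le> 1 * 2 * n"
      using e p n r by (intro mult_mono mult_nonneg_nonneg) auto
    then have "- (2 * n) \<le> exp (- L / (1 - r)) * (1 / (1 - r) ^ 4) * (- n)" by simp
    also have "\<dots> \<le> exp (- L / (1 - r)) * (1 / (1 - r) ^ 4) * (r * (L - 2 * (1 - r)) - n * (1 - r)\<^sup>2)"
      using b r by (intro mult_left_mono) auto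
    finally have "L * - (2 * n) \<le> L * (exp (- L / (1 - r)) * (1 / (1 - r) ^ 4) * (r * (L - 2 * (1 - r)) - n * (1 - r)\<^sup>2))"
      using n by (intro mult_left_mono) (auto simp: L)
    then show ?thesis unfolding formula[OF Rs] by (simp add: n_def mult_ac)
  qed
qed

lemma continuous_on_flat [continuous_intros]:
  assumes "l > 0" "continuous_on S f"
  shows "continuous_on S (\<lambda>x. flat l k (f x))"
proof -
  have "isCont (flat l k) t" for t
    using flat_has_derivative[OF assms(1)] DERIV_isCont by blast
  then have "continuous_on UNIV (flat l k)" by (simp add: continuous_on_eq_continuous_at)
  from continuous_on_compose2[OF this assms(2)] show ?thesis by simp
qed

lemma continuous_on_bump_laplacian:
  "l > 0 \<Longrightarrow> continuous_on S (bump_laplacian l x s)"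
  unfolding bump_laplacian_def[abs_def] Let_def by (intro continuous_intros)

text \<open>
  The diagonal coefficients of the current \<open>\<partial>\<partial>-bar u\<close> add up to a multiple of the distributional Laplacian
  of \<open>u\<close>, which is tested on the bump here.
\<close>

lemma pluriharmonic_integral_bump_laplacian:
  fixes u :: "complex ^ 'n::finite \<Rightarrow> real"
  assumes u: "pluriharmonic_on \<Omega> u" and \<Omega>: "cball x s \<subseteq> \<Omega>" and "l > 0" "s > 0"
  shows "integrable lborel (\<lambda>y. indicator (cball x s) y *\<^sub>R (u y * bump_laplacian l x s y))"
    and "(LINT y|lborel. indicator (cball x s) y *\<^sub>R (u y * bump_laplacian l x s y)) = 0"
proof -
  define W where "W = (\<lambda>j. wirt j (wirt_bar j (bump l x s)))"
  have cu: "continuous_on (cball x s) u"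
    using u \<Omega> by (auto simp: pluriharmonic_on_def intro: continuous_on_subset)
  show int: "integrable lborel (\<lambda>y. indicator (cball x s) y *\<^sub>R (u y * bump_laplacian l x s y))"
    by (intro borel_integrable_compact continuous_intros cu continuous_on_bump_laplacian assms) simp
  have cW: "continuous_on (cball x s) (W j)" for j
    unfolding W_def wirt_wirt_bar_bump[OF assms(3), abs_def] by (intro continuous_intros assms)
  have W0: "W j y = 0" if "y \<notin> cball x s" for j y
  proof -
    have "s < norm (y - x)" using that by (simp add: dist_norm norm_minus_commute)
    then have "s\<^sup>2 < (norm (y - x))\<^sup>2" using assms(4) by (intro power_strict_mono) auto
    then show ?thesis by (simp add: W_def wirt_wirt_bar_bump[OF assms(3)] flat_def)
  qed
  have intW: "integrable lborel (\<lambda>y. indicator (cball x s) y *\<^sub>R (complex_of_real (u y) * W j y))" for j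
    by (intro borel_integrable_compact continuous_intros cu cW) simp
  have "(LINT y|lborel. indicator (cball x s) y *\<^sub>R (complex_of_real (u y) * W j y)) = 0" for j
  proof -
    have "(LINT y:\<Omega>|lborel. complex_of_real (u y) * W j y) = 0"
      using u bump_test_function[OF assms(3,4) \<Omega>] by (auto simp: pluriharmonic_on_def W_def)
    also have "(LINT y:\<Omega>|lborel. complex_of_real (u y) * W j y) =
        (LINT y|lborel. indicator (cball x s) y *\<^sub>R (complex_of_real (u y) * W j y))"
      unfolding set_lebesgue_integral_def
      using \<Omega> W0[of _ j] by (intro Bochner_Integration.integral_cong) (auto simp: indicator_def)
    finally show ?thesis .
  qed
  then have "0 = (\<Sum>j\<in>UNIV. LINT y|lborel. indicator (cball x s) y *\<^sub>R (complex_of_real (u y) * W j y))"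
    by simp
  also have "\<dots> = (LINT y|lborel. (\<Sum>j\<in>UNIV. indicator (cball x s) y *\<^sub>R (complex_of_real (u y) * W j y)))"
    by (intro Bochner_Integration.integral_sum[symmetric] intW)
  also have "\<dots> = (LINT y|lborel. complex_of_real (indicator (cball x s) y *\<^sub>R (u y * bump_laplacian l x s y)))"
    unfolding scaleR_sum_right[symmetric] sum_distrib_left[symmetric] W_def
      sum_wirt_wirt_bar_bump[OF assms(3)]
    by (intro Bochner_Integration.integral_cong) (auto simp: bump_laplacian_def Let_def scaleR_conv_of_real)
  also have "\<dots> = of_real (LINT y|lborel. indicator (cball x s) y *\<^sub>R (u y * bump_laplacian l x s y))"
    by (rule integral_complex_of_real)
  finally show "(LINT y|lborel. indicator (cball x s) y *\<^sub>R (u y * bump_laplacian l x s y)) = 0"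
    by simp
qed

text \<open>
  A weak form of Harnack's inequality. The integral of \<open>u\<close> against the Laplacian of the bump is
  zero, and this Laplacian is negative at most on the small ball, while it is bounded below by a positive
  constant on the rest of the ball of radius \<open>4/5 s\<close>. So the mass of \<open>u\<close> on the large ball is
  controlled by that on the small one. The constant depends on the dimension alone, since the
  estimates of \<open>bump_laplacian_bounds\<close> are invariant under scaling.
\<close>

lemma pluriharmonic_doubling:
  fixes u :: "complex ^ 'n::finite \<Rightarrow> real"
  assumes u: "pluriharmonic_on \<Omega> u" and \<Omega>: "cball x s \<subseteq> \<Omega>" and s: "s > 0"
    and nonneg: "\<And>y. y \<in> cball x s \<Longrightarrow> 0 \<le> u y"
  shows "(LINT y:ball x (4/5 * s)|lborel. u y) \<le>
     (1 + 2 * CARD('n) * exp (3 * (12 * CARD('n) + 14))) * (LINT y:ball x (3/10 * s)|lborel. u y)"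
proof -
  define n L \<kappa> where "n = real CARD('n)" and "L = 12 * n + 14" and "\<kappa> = L * exp (- 3 * L)"
  have L: "L > 0" and \<kappa>: "\<kappa> > 0" by (auto simp: L_def n_def \<kappa>_def add_nonneg_pos)
  define q where "q = bump_laplacian (L * s\<^sup>2) x s"
  have "L * s\<^sup>2 > 0" using L s by simp
  note q = pluriharmonic_integral_bump_laplacian[OF u \<Omega> this s, folded q_def]
  have cu: "continuous_on (cball x s) u"
    using u \<Omega> by (auto simp: pluriharmonic_on_def intro: continuous_on_subset)
  have "set_integrable lborel (cball x s) u"
    unfolding set_integrable_def by (intro borel_integrable_compact cu) simp
  then have int: "set_integrable lborel (ball x (4/5 * s)) u" "set_integrable lborel (ball x (3/10 * s)) u"
    using s by (auto elim!: set_integrable_subset)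
  \<comment> \<open>The factor \<open>s\<^sup>2 q\<close> is at least \<open>\<kappa>\<close> on the annulus between the two radii and at least \<open>- 2 n L\<close> on the small ball.\<close>
  have pw: "\<kappa> * (indicator (ball x (4/5 * s)) y *\<^sub>R u y) - (\<kappa> + 2 * n * L) * (indicator (ball x (3/10 * s)) y *\<^sub>R u y)
      \<le> s\<^sup>2 * (indicator (cball x s) y *\<^sub>R (u y * q y))" for y
  proof (cases "y \<in> cball x s")
    case False
    then show ?thesis using s by auto
  next
    case True
    have d: "dist x y = norm (y - x)" by (simp add: dist_norm norm_minus_commute)
    have b: "(\<kappa> * indicator (ball x (4/5 * s)) y - (\<kappa> + 2 * n * L) * indicator (ball x (3/10 * s)) y) \<le> s\<^sup>2 * q y"
      using bump_laplacian_nonneg[OF s, of y x] bump_laplacian_ge[OF s, of y x] bump_laplacian_ge_centre[OF s, of y x] s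
      unfolding q_def \<kappa>_def L_def n_def indicator_def mem_ball d
      by (auto simp: not_less)
    have "u y * (\<kappa> * indicator (ball x (4/5 * s)) y - (\<kappa> + 2 * n * L) * indicator (ball x (3/10 * s)) y) \<le> u y * (s\<^sup>2 * q y)"
      by (rule mult_left_mono[OF b nonneg[OF True]])
    then show ?thesis using True by (simp add: algebra_simps)
  qed
  have "\<kappa> * (LINT y:ball x (4/5 * s)|lborel. u y) - (\<kappa> + 2 * n * L) * (LINT y:ball x (3/10 * s)|lborel. u y)
     = (LINT y|lborel. \<kappa> * (indicator (ball x (4/5 * s)) y *\<^sub>R u y) - (\<kappa> + 2 * n * L) * (indicator (ball x (3/10 * s)) y *\<^sub>R u y))"
    using int by (simp add: set_lebesgue_integral_def set_integrable_def)
  also have "\<dots> \<le> (LINT y|lborel. s\<^sup>2 * (indicator (cball x s) y *\<^sub>R (u y * q y)))"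
    using int q(1) unfolding set_integrable_def
    by (intro integral_mono pw Bochner_Integration.integrable_diff integrable_mult_right)
  also have "\<dots> = 0" using q(2) by simp
  finally have "(LINT y:ball x (4/5 * s)|lborel. u y) \<le> (\<kappa> + 2 * n * L) / \<kappa> * (LINT y:ball x (3/10 * s)|lborel. u y)"
    using \<kappa> by (simp add: field_simps)
  also have "(\<kappa> + 2 * n * L) / \<kappa> = 1 + 2 * n * exp (3 * L)"
    using L by (simp add: \<kappa>_def field_simps exp_minus)
  finally show ?thesis by (simp add: n_def L_def)
qed

section \<open>The order of vanishing at a boundary point\<close>

lemma set_integral_mono_set_nonneg:
  fixes u :: "'a \<Rightarrow> real"
  assumes "set_integrable M B u" "A \<in> sets M" "A \<subseteq> B" "\<And>y. y \<in> B \<Longrightarrow> 0 \<le> u y"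
  shows "(LINT y:A|M. u y) \<le> (LINT y:B|M. u y)"
  using assms set_integrable_subset[OF assms(1-3)]
  unfolding set_lebesgue_integral_def set_integrable_def
  by (intro integral_mono) (auto split: split_indicator)

text \<open>
  A Hopf-type lemma of finite order: a positive pluriharmonic function on a ball does not
  decay faster than a fixed power of the distance to a boundary point \<open>q\<close>. Let \<open>z\<^sub>k\<close> run along the
  radius to \<open>q\<close> with \<open>\<parallel>z\<^sub>k - q\<parallel> = d\<^sub>k\<close> shrinking by the factor \<open>3/4\<close>. The ball of radius \<open>d\<^sub>k / 4\<close> about
  \<open>z\<^sub>k\<close> lies within the ball of radius \<open>d\<^sub>k / 2\<close> about \<open>z\<^bsub>k+1\<^esub>\<close>, so doubling shows that the mass \<open>I\<^sub>k\<close> of \<open>u\<close> on the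
  former decreases at most by the doubling constant \<open>\<theta>\<close> as a factor at each step. A bound \<open>u \<le> c \<parallel>y - q\<parallel>\<^sup>\<beta>\<close> would force \<open>I\<^sub>k\<close> to
  decrease like \<open>(3/4)\<^sup>\<beta>\<^sup>k\<close>, which is faster when \<open>\<theta> (3/4)\<^sup>\<beta> < 1\<close>.
\<close>

lemma pluriharmonic_not_flat_at_boundary_point:
  fixes u :: "complex ^ 'n::finite \<Rightarrow> real"
  defines "\<theta> \<equiv> 1 + 2 * CARD('n) * exp (3 * (12 * CARD('n) + 14))"
  assumes u: "pluriharmonic_on \<Omega> u" and \<Omega>: "ball p (dist p q) \<subseteq> \<Omega>" and pq: "p \<noteq> q"
    and pos: "\<And>y. y \<in> ball p (dist p q) \<Longrightarrow> 0 < u y"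
    and \<beta>: "0 < \<beta>" "\<theta> * (3/4) powr \<beta> < 1"
    and c: "0 \<le> c"
  shows "\<exists>y \<in> ball p (dist p q). c * dist y q powr \<beta> < u y"
proof (rule ccontr)
  assume "\<not> ?thesis"
  then have le: "u y \<le> c * dist y q powr \<beta>" if "y \<in> ball p (dist p q)" for y
    using that by (auto simp: not_less)
  define \<rho> where "\<rho> = dist p q"
  have \<rho>: "\<rho> > 0" using pq by (simp add: \<rho>_def)
  define z where "z = (\<lambda>k. q + (3/4) ^ k *\<^sub>R (p - q))"
  define d where "d = (\<lambda>k::nat. (3/4) ^ k * \<rho>)"
  have d: "d k > 0" and dS: "d (Suc k) = 3/4 * d k" for k using \<rho> by (auto simp: d_def)
  have zq: "dist (z k) q = d k" for k
    by (simp add: z_def d_def \<rho>_def dist_norm)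
  have pz: "dist p (z k) = \<rho> - d k" for k
  proof -
    have "p - z k = (1 - (3/4) ^ k) *\<^sub>R (p - q)" by (simp add: z_def algebra_simps)
    then have "dist p (z k) = \<bar>1 - (3/4) ^ k\<bar> * \<rho>" by (simp add: dist_norm \<rho>_def)
    also have "\<bar>1 - (3/4::real) ^ k\<bar> = 1 - (3/4) ^ k" by (simp add: power_le_one)
    finally show ?thesis by (simp add: d_def algebra_simps)
  qed
  have zz: "dist (z (Suc k)) (z k) = d k / 4" for k
  proof -
    have "z (Suc k) - z k = ((3/4) ^ Suc k - (3/4) ^ k) *\<^sub>R (p - q)"
      unfolding z_def scaleR_diff_left by simp
    then show ?thesis by (simp add: dist_norm d_def \<rho>_def)
  qed
  have sub: "ball (z k) (d k) \<subseteq> ball p \<rho>" for k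
    by (simp add: ball_subset_ball_iff pz dist_commute)
  have cu: "continuous_on \<Omega> u" using u by (simp add: pluriharmonic_on_def)
  have int: "set_integrable lborel (ball x r) u" if "cball x r \<subseteq> ball p \<rho>" for x r
  proof -
    have "continuous_on (cball x r) u"
      using that \<Omega> by (intro continuous_on_subset[OF cu]) (auto simp: \<rho>_def)
    then have "set_integrable lborel (cball x r) u"
      unfolding set_integrable_def by (intro borel_integrable_compact) auto
    then show ?thesis by (rule set_integrable_subset) auto
  qed
  have cb: "cball (z k) r \<subseteq> ball p \<rho>" if "r < d k" for k r
    using that sub[of k] by (auto simp: subset_eq)
  define I where "I = (\<lambda>k. LINT y:ball (z k) (d k / 4)|lborel. u y)"
  have step: "I k \<le> \<theta> * I (Suc k)" for k
  proof -
    \<comment> \<open>This \<open>s\<close> makes \<open>4/5 s = d\<^sub>k / 2\<close> and \<open>3/10 s = d\<^bsub>k+1\<^esub> / 4\<close>, while \<open>s < d\<^bsub>k+1\<^esub> = 3/4 d\<^sub>k\<close>.\<close>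
    define s where "s = 5/8 * d k"
    have s: "s > 0" "s < d (Suc k)" using d[of k] by (auto simp: s_def dS)
    have "I k \<le> (LINT y:ball (z (Suc k)) (4/5 * s)|lborel. u y)"
      unfolding I_def
    proof (rule set_integral_mono_set_nonneg)
      show "set_integrable lborel (ball (z (Suc k)) (4/5 * s)) u"
        by (intro int cb) (use s in auto)
      show "ball (z k) (d k / 4) \<subseteq> ball (z (Suc k)) (4/5 * s)"
        using zz[of k] by (simp add: ball_subset_ball_iff s_def dist_commute)
      show "0 \<le> u y" if "y \<in> ball (z (Suc k)) (4/5 * s)" for y
        using that cb[of "4/5 * s" "Suc k"] s pos[of y] by (force simp: \<rho>_def)
    qed simp
    also have "\<dots> \<le> \<theta> * (LINT y:ball (z (Suc k)) (3/10 * s)|lborel. u y)"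
      unfolding \<theta>_def
    proof (rule pluriharmonic_doubling[OF u _ s(1)])
      show "cball (z (Suc k)) s \<subseteq> \<Omega>" using cb[OF s(2)] \<Omega> by (auto simp: \<rho>_def)
      show "0 \<le> u y" if "y \<in> cball (z (Suc k)) s" for y
        using that cb[OF s(2)] pos[of y] by (force simp: \<rho>_def)
    qed
    also have "3/10 * s = d (Suc k) / 4" by (simp add: s_def dS)
    finally show ?thesis by (simp add: I_def)
  qed
  have \<theta>: "\<theta> \<ge> 1" by (simp add: \<theta>_def)
  have chain: "I 0 \<le> \<theta> ^ k * I k" for k
  proof (induction k)
    case (Suc k)
    have "\<theta> ^ k * I k \<le> \<theta> ^ k * (\<theta> * I (Suc k))" using \<theta> by (intro mult_left_mono step) auto
    with Suc.IH show ?case by (simp add: mult_ac)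
  qed simp
  define V where "V = measure lborel (ball p \<rho>)"
  define B where "B = c * (5/4 * \<rho>) powr \<beta> * V"
  have upper: "I k \<le> B * ((3/4) powr \<beta>) ^ k" for k
  proof -
    define D where "D = c * (5/4 * d k) powr \<beta>"
    have D: "D \<ge> 0" using c by (simp add: D_def)
    have "I k \<le> (LINT y:ball (z k) (d k / 4)|lborel. D)"
      unfolding I_def
    proof (rule set_integral_mono)
      show "set_integrable lborel (ball (z k) (d k / 4)) u"
        by (intro int cb) (use d[of k] in auto)
      show "set_integrable lborel (ball (z k) (d k / 4)) (\<lambda>y. D)"
        unfolding set_integrable_def
        using emeasure_lborel_ball_finite by (intro integrable_scaleR_left integrable_real_indicator) auto
      fix y assume y: "y \<in> ball (z k) (d k / 4)"
      then have "y \<in> ball (z k) (d k)" using d[of k] by auto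
      then have "y \<in> ball p \<rho>" using sub by blast
      then have "u y \<le> c * dist y q powr \<beta>" using le by (simp add: \<rho>_def)
      also have "dist y q \<le> 5/4 * d k"
        using y dist_triangle[of y q "z k"] zq[of k] by (simp add: dist_commute)
      then have "c * dist y q powr \<beta> \<le> D"
        unfolding D_def using \<beta>(1) c by (intro mult_left_mono powr_mono2) auto
      finally show "u y \<le> D" .
    qed
    also have "\<dots> = measure lborel (ball (z k) (d k / 4)) * D"
      using emeasure_lborel_ball_finite[of "z k" "d k / 4"] by (subst set_integral_const) auto
    also have "\<dots> \<le> V * D"
      unfolding V_def
    proof (intro mult_right_mono D measure_mono_fmeasurable)
      show "ball (z k) (d k / 4) \<subseteq> ball p \<rho>" using sub[of k] d[of k] by (auto simp: subset_eq)
      show "ball p \<rho> \<in> fmeasurable lborel" using emeasure_lborel_ball_finite by (auto simp: fmeasurable_def)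
    qed simp
    also have "D = c * ((5/4 * \<rho>) powr \<beta> * ((3/4) powr \<beta>) ^ k)"
    proof -
      have "5/4 * d k = (5/4 * \<rho>) * (3/4) ^ k" by (simp add: d_def)
      then have "(5/4 * d k) powr \<beta> = (5/4 * \<rho>) powr \<beta> * ((3/4) ^ k) powr \<beta>"
        using \<rho> by (simp only:) (rule powr_mult; simp)
      moreover have "((3/4::real) ^ k) powr \<beta> = ((3/4) powr \<beta>) ^ k"
        by (simp add: powr_realpow[symmetric] powr_powr powr_power mult.commute)
      ultimately show ?thesis by (simp only: D_def)
    qed
    finally show ?thesis by (simp add: B_def mult_ac)
  qed
  define x where "x = \<theta> * (3/4) powr \<beta>"
  have x: "0 \<le> x" "x < 1" using \<beta> \<theta> by (auto simp: x_def)
  have "I 0 \<le> B * x ^ k" for k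
  proof -
    have "I 0 \<le> \<theta> ^ k * (B * ((3/4) powr \<beta>) ^ k)"
      using \<theta> by (intro order_trans[OF chain[of k]] mult_left_mono upper) auto
    then show ?thesis by (simp add: x_def power_mult_distrib mult_ac)
  qed
  moreover have "(\<lambda>k. B * x ^ k) \<longlonglongrightarrow> B * 0"
    using x by (intro tendsto_intros LIMSEQ_power_zero) auto
  ultimately have "I 0 \<le> 0"
    by (intro LIMSEQ_le_const[where X="\<lambda>k. B * x ^ k"]) auto
  moreover have "I 0 > 0"
  proof -
    have z0: "z 0 = p" "d 0 = \<rho>" by (auto simp: z_def d_def)
    have sb: "cball p (\<rho>/4) \<subseteq> ball p \<rho>" using \<rho> by (auto simp: subset_eq)
    have "continuous_on (cball p (\<rho>/4)) u"
      using sb \<Omega> by (intro continuous_on_subset[OF cu]) (auto simp: \<rho>_def)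
    then obtain y0 where y0: "y0 \<in> cball p (\<rho>/4)" "\<And>y. y \<in> cball p (\<rho>/4) \<Longrightarrow> u y0 \<le> u y"
      using continuous_attains_inf[of "cball p (\<rho>/4)" u] \<rho> by auto
    have "0 < u y0" using y0(1) sb pos by (auto simp: \<rho>_def)
    then have "0 < measure lborel (ball p (\<rho>/4)) *\<^sub>R u y0"
      using content_ball_pos[of "\<rho>/4" p] \<rho> by simp
    also have "\<dots> = (LINT y:ball p (\<rho>/4)|lborel. u y0)"
      using emeasure_lborel_ball_finite[of p "\<rho>/4"] by (subst set_integral_const) auto
    also have "\<dots> \<le> (LINT y:ball p (\<rho>/4)|lborel. u y)"
    proof (rule set_integral_mono)
      show "set_integrable lborel (ball p (\<rho>/4)) (\<lambda>y. u y0)"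
        unfolding set_integrable_def
        using emeasure_lborel_ball_finite by (intro integrable_scaleR_left integrable_real_indicator) auto
      show "set_integrable lborel (ball p (\<rho>/4)) u" by (rule int[OF sb])
    qed (use y0 in auto)
    finally show ?thesis by (simp add: I_def z0)
  qed
  ultimately show False by simp
qed

section \<open>Circle means of \<open>ln (1 + \<bar>P\<bar>\<^sup>2)\<close>\<close>

text \<open>
  For a holomorphic \<open>F\<close> with value \<open>a\<close> and derivatives \<open>b\<close>, \<open>c\<close> at a point, the two sides are the
  second derivatives \<open>U\<^sub>s\<^sub>s\<close> and \<open>- U\<^sub>t\<^sub>t\<close> of \<open>U = ln (1 + \<bar>F (s + i t)\<bar>\<^sup>2)\<close>. Their difference is the Laplacian
  \<open>4 \<bar>b\<bar>\<^sup>2 / N\<^sup>2\<close> of \<open>U\<close>, because \<open>(a \<bullet> b)\<^sup>2 + (a \<bullet> \<i> b)\<^sup>2 = \<bar>a\<bar>\<^sup>2 \<bar>b\<bar>\<^sup>2\<close>.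
\<close>

lemma log_one_plus_square_laplacian_nonneg:
  fixes a b c :: complex
  defines "N \<equiv> 1 + a \<bullet> a"
  shows "(2 * (b \<bullet> b) + 2 * (a \<bullet> c)) / N - (2 * (a \<bullet> b))\<^sup>2 / N\<^sup>2
     \<ge> - ((2 * (b \<bullet> b) - 2 * (a \<bullet> c)) / N - (2 * (a \<bullet> (\<i> * b)))\<^sup>2 / N\<^sup>2)"
proof -
  have N: "N > 0" by (simp add: N_def add_pos_nonneg)
  have e: "(a \<bullet> b)\<^sup>2 + (a \<bullet> (\<i> * b))\<^sup>2 = (a \<bullet> a) * (b \<bullet> b)"
    by (simp add: inner_complex_def power2_eq_square algebra_simps)
  have "(2 * (b \<bullet> b) + 2 * (a \<bullet> c)) / N - (2 * (a \<bullet> b))\<^sup>2 / N\<^sup>2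
     + ((2 * (b \<bullet> b) - 2 * (a \<bullet> c)) / N - (2 * (a \<bullet> (\<i> * b)))\<^sup>2 / N\<^sup>2)
     = 4 * (b \<bullet> b) / N - 4 * ((a \<bullet> b)\<^sup>2 + (a \<bullet> (\<i> * b))\<^sup>2) / N\<^sup>2"
    using N by (simp add: field_simps power2_eq_square)
  also have "\<dots> = 4 * (b \<bullet> b) / N\<^sup>2"
    unfolding e using N by (simp add: N_def divide_simps power2_eq_square) (simp add: algebra_simps)
  also have "\<dots> \<ge> 0" by simp
  finally show ?thesis by linarith
qed

lemma poly_exp_vector_derivative_real_part:
  "((\<lambda>s. poly P (exp (Complex s t))) has_vector_derivative
     poly (pderiv P) (exp (Complex s t)) * exp (Complex s t)) (at s)"
proof -
  have "((\<lambda>s. exp (of_real s + \<i> * of_real t)) has_vector_derivative exp (of_real s + \<i> * of_real t)) (at s)"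
    by (auto intro!: derivative_eq_intros has_vector_derivative_real_field)
  then have "((poly P \<circ> (\<lambda>s. exp (of_real s + \<i> * of_real t))) has_vector_derivative
      exp (of_real s + \<i> * of_real t) * poly (pderiv P) (exp (of_real s + \<i> * of_real t))) (at s)"
    by (rule field_vector_diff_chain_at) (rule poly_DERIV)
  then show ?thesis by (simp add: o_def Complex_eq mult.commute)
qed

lemma poly_exp_vector_derivative_imag_part:
  "((\<lambda>t. poly P (exp (Complex s t))) has_vector_derivative
     \<i> * (poly (pderiv P) (exp (Complex s t)) * exp (Complex s t))) (at t)"
proof -
  have "((\<lambda>t. exp (of_real s + \<i> * of_real t)) has_vector_derivative \<i> * exp (of_real s + \<i> * of_real t)) (at t)"
    by (auto intro!: derivative_eq_intros has_vector_derivative_real_field)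
  then have "((poly P \<circ> (\<lambda>t. exp (of_real s + \<i> * of_real t))) has_vector_derivative
      \<i> * exp (of_real s + \<i> * of_real t) * poly (pderiv P) (exp (of_real s + \<i> * of_real t))) (at t)"
    by (rule field_vector_diff_chain_at) (rule poly_DERIV)
  then show ?thesis by (simp add: o_def Complex_eq mult_ac)
qed

lemma inner_has_real_derivative:
  fixes f g :: "real \<Rightarrow> complex"
  assumes "(f has_vector_derivative f') (at x)" "(g has_vector_derivative g') (at x)"
  shows "((\<lambda>x. f x \<bullet> g x) has_real_derivative f x \<bullet> g' + f' \<bullet> g x) (at x)"
  using has_derivative_inner[OF assms[unfolded has_vector_derivative_def]]
  unfolding has_field_derivative_def
  by (rule has_derivative_eq_rhs) (simp add: algebra_simps fun_eq_iff)
 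
text \<open>
  The three-circles principle for integral means. In the logarithmic coordinate \<open>s + i t\<close> the second
  derivative of the integral is the integral of \<open>U\<^sub>s\<^sub>s \<ge> - U\<^sub>t\<^sub>t\<close>, and the integral of \<open>U\<^sub>t\<^sub>t\<close> over a full period
  of \<open>t\<close> vanishes.
\<close>

lemma convex_circle_integral_log_one_plus_square:
  fixes P :: "complex poly"
  shows "convex_on UNIV (\<lambda>s. integral {0..2 * pi} (\<lambda>t. ln (1 + (norm (poly P (exp (Complex s t))))\<^sup>2)))"
proof -
  define E F F1 F2 where "E = (\<lambda>s t. exp (Complex s t))"
    and "F = (\<lambda>s t. poly P (E s t))"
    and "F1 = (\<lambda>s t. poly (pderiv P) (E s t) * E s t)"
    and "F2 = (\<lambda>s t. poly (pderiv ([:0, 1:] * pderiv P)) (E s t) * E s t)"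
  define N where "N = (\<lambda>s t. 1 + F s t \<bullet> F s t)"
  define Us Ut where "Us = (\<lambda>s t. 2 * (F s t \<bullet> F1 s t) / N s t)"
    and "Ut = (\<lambda>s t. 2 * (F s t \<bullet> (\<i> * F1 s t)) / N s t)"
  define Uss Utt where
    "Uss = (\<lambda>s t. (2 * (F1 s t \<bullet> F1 s t) + 2 * (F s t \<bullet> F2 s t)) / N s t - (2 * (F s t \<bullet> F1 s t))\<^sup>2 / (N s t)\<^sup>2)"
    and "Utt = (\<lambda>s t. (2 * (F1 s t \<bullet> F1 s t) - 2 * (F s t \<bullet> F2 s t)) / N s t - (2 * (F s t \<bullet> (\<i> * F1 s t)))\<^sup>2 / (N s t)\<^sup>2)"
  have N: "N s t > 0" for s t by (simp add: N_def add_pos_nonneg)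
  have Fs: "((\<lambda>s. F s t) has_vector_derivative F1 s t) (at s)"
    and Ft: "((\<lambda>t. F s t) has_vector_derivative \<i> * F1 s t) (at t)" for s t
    unfolding F_def F1_def E_def
    by (rule poly_exp_vector_derivative_real_part poly_exp_vector_derivative_imag_part)+
  \<comment> \<open>Since \<open>F1\<close> is again a polynomial in \<open>exp (s + i t)\<close>, namely \<open>z P'(z)\<close>, the same rules differentiate it.\<close>
  have F1': "F1 = (\<lambda>s t. poly ([:0, 1:] * pderiv P) (E s t))"
    by (simp add: F1_def mult.commute)
  have F1s: "((\<lambda>s. F1 s t) has_vector_derivative F2 s t) (at s)"
    and F1t: "((\<lambda>t. F1 s t) has_vector_derivative \<i> * F2 s t) (at t)" for s t
    unfolding F1' F2_def E_def
    by (rule poly_exp_vector_derivative_real_part poly_exp_vector_derivative_imag_part)+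
  have iF1t: "((\<lambda>t. \<i> * F1 s t) has_vector_derivative - F2 s t) (at t)" for s t
    using has_vector_derivative_mult_right[OF F1t[of s t], of \<i>] by simp
  have Ns: "((\<lambda>s. N s t) has_real_derivative 2 * (F s t \<bullet> F1 s t)) (at s)"
    and Nt: "((\<lambda>t. N s t) has_real_derivative 2 * (F s t \<bullet> (\<i> * F1 s t))) (at t)" for s t
    unfolding N_def
    by (auto intro!: derivative_eq_intros inner_has_real_derivative[OF Fs Fs] inner_has_real_derivative[OF Ft Ft]
        simp: inner_commute)
  have Us: "((\<lambda>s. ln (N s t)) has_real_derivative Us s t) (at s)" for s t
    using N[of s t] by (auto intro!: derivative_eq_intros Ns simp: Us_def)
  have Uss: "((\<lambda>s. Us s t) has_real_derivative Uss s t) (at s)" for s t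
    unfolding Us_def using N[of s t]
    by (auto intro!: derivative_eq_intros Ns inner_has_real_derivative[OF Fs F1s] simp: Uss_def)
      (simp add: field_simps power2_eq_square)
  have Utt: "((\<lambda>t. Ut s t) has_real_derivative Utt s t) (at t)" for s t
    unfolding Ut_def using N[of s t]
    by (auto intro!: derivative_eq_intros Nt inner_has_real_derivative[OF Ft iF1t] simp: Utt_def)
      (simp add: field_simps power2_eq_square inner_complex_def)
  have cE: "continuous_on UNIV (\<lambda>(s, t). E s t)"
    unfolding E_def Complex_eq by (auto simp: case_prod_beta intro!: continuous_intros)
  have cF: "continuous_on UNIV (\<lambda>x. F (fst x) (snd x))" "continuous_on UNIV (\<lambda>x. F1 (fst x) (snd x))"
    "continuous_on UNIV (\<lambda>x. F2 (fst x) (snd x))"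
    unfolding F_def F1_def F2_def using cE
    by (auto simp: case_prod_beta intro!: continuous_intros)
  have cN: "continuous_on UNIV (\<lambda>x. N (fst x) (snd x))"
    unfolding N_def by (intro continuous_intros cF)
  have N0: "N s t \<noteq> 0" for s t using N[of s t] by simp
  have cU: "continuous_on UNIV (\<lambda>x. ln (N (fst x) (snd x)))" "continuous_on UNIV (\<lambda>x. Us (fst x) (snd x))"
    "continuous_on UNIV (\<lambda>x. Uss (fst x) (snd x))"
    unfolding Us_def Uss_def by (auto intro!: continuous_intros cF cN simp: N0)
  have pair: "continuous_on UNIV (\<lambda>t. h s t)" if "continuous_on UNIV (\<lambda>x. h (fst x) (snd x))" for h :: "real \<Rightarrow> real \<Rightarrow> real" and s
  proof -
    have "continuous_on UNIV (\<lambda>t. (s, t))"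
      by (intro continuous_on_Pair continuous_on_const continuous_on_id)
    from continuous_on_compose2[OF that this] show ?thesis by simp
  qed
  have int: "(\<lambda>t. h s t) integrable_on {0..2*pi}" if "continuous_on UNIV (\<lambda>x. h (fst x) (snd x))" for h :: "real \<Rightarrow> real \<Rightarrow> real" and s
    using pair[OF that] by (intro integrable_continuous_real) (rule continuous_on_subset, auto)
  note cu = continuous_on_subset[OF _ subset_UNIV]
  have M1: "((\<lambda>s. integral {0..2*pi} (\<lambda>t. ln (N s t))) has_real_derivative integral {0..2*pi} (Us s)) (at s)" for s
    using leibniz_rule_field_derivative[of UNIV 0 "2*pi" "\<lambda>s t. ln (N s t)" Us s]
    using int[OF cU(1)] by (simp add: Us cU cu case_prod_beta)
  have M2: "((\<lambda>s. integral {0..2*pi} (Us s)) has_real_derivative integral {0..2*pi} (Uss s)) (at s)" for s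
    using leibniz_rule_field_derivative[of UNIV 0 "2*pi" Us Uss s]
    using int[OF cU(2)] by (simp add: Uss cU cu case_prod_beta)
  have "0 \<le> integral {0..2*pi} (Uss s)" for s
  proof -
    have per: "Ut s (2*pi) = Ut s 0"
      by (simp add: Ut_def N_def F_def F1_def E_def exp_eq_polar)
    have "(Utt s has_integral (Ut s (2*pi) - Ut s 0)) {0..2*pi}"
    proof (rule fundamental_theorem_of_calculus)
      show "(Ut s has_vector_derivative Utt s t) (at t within {0..2*pi})" for t
        using has_field_derivative_at_within[OF Utt] has_real_derivative_iff_has_vector_derivative by blast
    qed simp
    then have "((\<lambda>t. - Utt s t) has_integral 0) {0..2*pi}"
      unfolding per by (auto dest: has_integral_neg)
    then show ?thesis
    proof (rule has_integral_le)
      show "(Uss s has_integral integral {0..2*pi} (Uss s)) {0..2*pi}"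
        using int[OF cU(3)] by blast
      show "- Utt s t \<le> Uss s t" if "t \<in> {0..2*pi}" for t
        using log_one_plus_square_laplacian_nonneg[where a="F s t" and b="F1 s t" and c="F2 s t"]
        by (simp add: Uss_def Utt_def N_def)
    qed
  qed
  then have "convex_on UNIV (\<lambda>s. integral {0..2*pi} (\<lambda>t. ln (N s t)))"
    by (intro f''_ge0_imp_convex[OF _ M1 M2]) auto
  then show ?thesis by (simp add: N_def F_def E_def power2_norm_eq_inner)
qed

text \<open>
  As \<open>s \<rightarrow> -\<infinity>\<close> the circles shrink to the centre and the means tend to the value there. A convex
  function with a finite limit at \<open>-\<infinity>\<close> is nowhere below this limit: let \<open>s \<rightarrow> \<infinity>\<close> in
  \<open>M (- s) \<le> (M 0 + M (- 2 s)) / 2\<close>.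
\<close>

lemma log_one_plus_poly_square_le_circle_integral:
  fixes P :: "complex poly"
  shows "2 * pi * ln (1 + (norm (poly P 0))\<^sup>2) \<le> integral {0..2 * pi} (\<lambda>t. ln (1 + (norm (poly P (cis t)))\<^sup>2))"
proof -
  define m where "m = (\<lambda>r. integral {0..2 * pi} (\<lambda>t. ln (1 + (norm (poly P (of_real r * cis t)))\<^sup>2)))"
  define M where "M = (\<lambda>s. m (exp s))"
  have pos: "1 + (norm z)\<^sup>2 \<noteq> 0" for z :: complex
    using zero_le_power2[of "norm z"] by linarith
  have "continuous_on UNIV (\<lambda>r. integral (cbox 0 (2 * pi)) (\<lambda>t. ln (1 + (norm (poly P (of_real r * cis t)))\<^sup>2)))"
    by (rule integral_continuous_on_param) (auto simp: case_prod_beta pos intro!: continuous_intros)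
  then have "isCont m 0"
    by (simp add: m_def continuous_on_eq_continuous_at)
  then have lim: "(m \<longlongrightarrow> m 0) (at 0)" by (simp add: isCont_def)
  have e: "filterlim (\<lambda>s::real. exp (- s)) (at 0) at_top"
    by (rule filterlim_atI) (auto intro!: filterlim_compose[OF exp_at_bot] filterlim_uminus_at_bot_at_top)
  have L1: "((\<lambda>s. M (- s)) \<longlongrightarrow> m 0) at_top"
    unfolding M_def using filterlim_compose[OF lim e] .
  have L2: "((\<lambda>s. M (- (2 * s))) \<longlongrightarrow> m 0) at_top"
    by (rule filterlim_compose[OF L1]) (rule filterlim_tendsto_pos_mult_at_top[OF tendsto_const _ filterlim_ident], simp)
  have cv: "convex_on UNIV M"
    using convex_circle_integral_log_one_plus_square[of P] by (simp add: M_def m_def exp_eq_polar)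
  have "M (- s) \<le> (1/2) * M 0 + (1/2) * M (- (2 * s))" for s
    using convex_onD[OF cv, of "1/2" 0 "- (2 * s)"] by simp
  then have "m 0 \<le> (1/2) * M 0 + (1/2) * m 0"
    by (intro tendsto_le[OF _ _ L1, of "\<lambda>s. (1/2) * M 0 + (1/2) * M (- (2 * s))"] tendsto_intros L2) auto
  then have "m 0 \<le> m 1" by (simp add: M_def)
  then show ?thesis by (simp add: m_def)
qed

section \<open>Positivity of the Green function off the polynomial hull\<close>

lemma complex_polynomial_on_line:
  fixes p :: "complex ^ 'n::finite \<Rightarrow> complex"
  assumes "complex_polynomial p"
  shows "\<exists>P. \<forall>\<zeta>. p (a + \<zeta> *s b) = poly P \<zeta>"
proof -
  obtain S :: "('n \<Rightarrow> nat) set" and c where p: "p = (\<lambda>z. \<Sum>\<alpha>\<in>S. c \<alpha> * (\<Prod>i\<in>UNIV. z $ i ^ \<alpha> i))"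
    using assms by (auto simp: complex_polynomial_def)
  show ?thesis
    by (rule exI[of _ "\<Sum>\<alpha>\<in>S. smult (c \<alpha>) (\<Prod>i\<in>UNIV. [:a $ i, b $ i:] ^ \<alpha> i)"])
      (simp add: p poly_sum poly_prod)
qed

lemma complex_polynomial_continuous:
  assumes "complex_polynomial p"
  shows "continuous_on S p"
  using assms by (auto simp: complex_polynomial_def intro!: continuous_intros)

lemma complex_polynomial_growth:
  fixes p :: "complex ^ 'n::finite \<Rightarrow> complex"
  assumes "complex_polynomial p"
  shows "\<exists>C d. d > 0 \<and> C > 0 \<and> (\<forall>z. 1 + (norm (p z))\<^sup>2 \<le> C * (1 + (norm z)\<^sup>2) ^ d)"
proof -
  obtain S :: "('n \<Rightarrow> nat) set" and c where S: "finite S" and p: "p = (\<lambda>z. \<Sum>\<alpha>\<in>S. c \<alpha> * (\<Prod>i\<in>UNIV. z $ i ^ \<alpha> i))"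
    using assms by (auto simp: complex_polynomial_def)
  define d where "d = Suc (\<Sum>\<alpha>\<in>S. \<Sum>i\<in>UNIV. \<alpha> i)"
  define K where "K = (\<Sum>\<alpha>\<in>S. norm (c \<alpha>))"
  have K: "K \<ge> 0" by (simp add: K_def sum_nonneg)
  have "1 + (norm (p z))\<^sup>2 \<le> (1 + K\<^sup>2) * (1 + (norm z)\<^sup>2) ^ d" for z
  proof -
    define w where "w = sqrt (1 + (norm z)\<^sup>2)"
    have w: "w \<ge> 1" by (simp add: w_def)
    have "norm (z $ i) \<le> w" for i
    proof -
      have "norm (z $ i) \<le> norm z" by (rule Finite_Cartesian_Product.norm_nth_le)
      also have "\<dots> \<le> w" unfolding w_def by (rule real_le_rsqrt) simp
      finally show ?thesis .
    qed
    then have m: "norm (\<Prod>i\<in>UNIV. z $ i ^ \<alpha> i) \<le> w ^ d" if "\<alpha> \<in> S" for \<alpha>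
    proof -
      have "norm (\<Prod>i\<in>UNIV. z $ i ^ \<alpha> i) = (\<Prod>i\<in>UNIV. norm (z $ i) ^ \<alpha> i)"
        by (simp add: prod_norm[symmetric] norm_power)
      also have "\<dots> \<le> (\<Prod>i\<in>UNIV. w ^ \<alpha> i)"
        using \<open>\<And>i. norm (z $ i) \<le> w\<close> by (intro prod_mono conjI power_mono) auto
      also have "\<dots> = w ^ (\<Sum>i\<in>UNIV. \<alpha> i)" by (simp add: power_sum)
      also have "\<dots> \<le> w ^ d"
      proof (rule power_increasing[OF _ w])
        have "(\<Sum>i\<in>UNIV. \<alpha> i) \<le> (\<Sum>\<alpha>\<in>S. \<Sum>i\<in>UNIV. \<alpha> i)"
          by (rule member_le_sum[OF that _ S, where f="\<lambda>\<alpha>. \<Sum>i\<in>UNIV. \<alpha> i"]) simp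
        then show "(\<Sum>i\<in>UNIV. \<alpha> i) \<le> d" by (simp add: d_def)
      qed
      finally show ?thesis .
    qed
    have "norm (p z) \<le> (\<Sum>\<alpha>\<in>S. norm (c \<alpha>) * w ^ d)"
      unfolding p by (intro sum_norm_le) (auto simp: norm_mult intro!: mult_left_mono m)
    also have "\<dots> = K * w ^ d" by (simp add: K_def sum_distrib_right)
    finally have "(norm (p z))\<^sup>2 \<le> (K * w ^ d)\<^sup>2" by (intro power_mono) auto
    also have "\<dots> = K\<^sup>2 * (w\<^sup>2) ^ d" by (simp add: power_mult_distrib power_mult[symmetric] mult.commute)
    finally have "1 + (norm (p z))\<^sup>2 \<le> 1 * (w\<^sup>2) ^ d + K\<^sup>2 * (w\<^sup>2) ^ d"
      using one_le_power[OF one_le_power[OF w, of 2], of d] by linarith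
    also have "w\<^sup>2 = 1 + (norm z)\<^sup>2" by (simp add: w_def)
    finally show ?thesis by (simp only: distrib_right)
  qed
  moreover have "1 + K\<^sup>2 > 0" by (simp add: add_pos_nonneg)
  ultimately show ?thesis by (intro exI[of _ "1 + K\<^sup>2"] exI[of _ d]) (auto simp: d_def)
qed

text \<open>
  For a continuous real function on the circle, the positive and the negative part have finite
  integrals, so the extended difference is an ordinary integral.
\<close>

lemma circle_mean_continuous:
  fixes g :: "complex ^ 'n \<Rightarrow> real"
  assumes "continuous_on {0..2 * pi} (\<lambda>t. g (a + cis t *s b))"
  shows "circle_mean (\<lambda>z. ereal (g z)) a b =
     ereal (1 / (2 * pi) * integral {0..2 * pi} (\<lambda>t. g (a + cis t *s b)))"
proof -
  define h where "h = (\<lambda>t. indicator {0..2*pi} t *\<^sub>R g (a + cis t *s b))"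
  have int: "integrable lborel h"
    unfolding h_def by (intro borel_integrable_compact assms) simp
  have e: "e2ennreal (ereal (g (a + cis t *s b))) * indicator {0..2*pi} t = ennreal (h t)"
    "e2ennreal (- ereal (g (a + cis t *s b))) * indicator {0..2*pi} t = ennreal (- h t)" for t
    by (auto simp: h_def indicator_def e2ennreal_ereal zero_ereal_def)
  have fin: "(\<integral>\<^sup>+ t. ennreal (h t) \<partial>lborel) \<noteq> \<infinity>" "(\<integral>\<^sup>+ t. ennreal (- h t) \<partial>lborel) \<noteq> \<infinity>"
    using int by (auto simp: real_integrable_def)
  have r: "enn2ereal x = ereal (enn2real x)" if "x \<noteq> \<infinity>" for x
    using that by (cases x) (auto simp: enn2ereal_ennreal)
  have "integral {0..2 * pi} (\<lambda>t. g (a + cis t *s b)) = (LINT t:{0..2*pi}|lborel. g (a + cis t *s b))"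
    using int by (intro set_borel_integral_eq_integral(2)[symmetric]) (simp add: set_integrable_def h_def)
  also have "\<dots> = enn2real (\<integral>\<^sup>+ t. ennreal (h t) \<partial>lborel) - enn2real (\<integral>\<^sup>+ t. ennreal (- h t) \<partial>lborel)"
    unfolding set_lebesgue_integral_def h_def[symmetric] by (rule real_lebesgue_integral_def[OF int])
  finally show ?thesis
    unfolding circle_mean_def e r[OF fin(1)] r[OF fin(2)] by simp
qed

text \<open>
  On a complex line \<open>p\<close> becomes a polynomial in one variable, to which the estimate for circle means
  applies. Unlike \<open>ln \<bar>p\<bar>\<close>, these functions have no poles, so all the integrals are finite.
\<close>

lemma plurisubharmonic_log_one_plus_square:
  fixes p :: "complex ^ 'n::finite \<Rightarrow> complex"
  assumes p: "complex_polynomial p" and m: "m \<ge> 0"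
  shows "plurisubharmonic (\<lambda>z. ereal (m * (ln (1 + (norm (p z))\<^sup>2) - C)))"
proof -
  define g where "g = (\<lambda>z. m * (ln (1 + (norm (p z))\<^sup>2) - C))"
  have pos: "1 + (norm z)\<^sup>2 \<noteq> 0" for z :: complex
    using zero_le_power2[of "norm z"] by linarith
  have cg: "continuous_on UNIV g"
    unfolding g_def using pos by (intro continuous_intros complex_polynomial_continuous[OF p]) auto
  have "open {z. ereal (g z) < c}" for c
    using cg by (intro open_Collect_less continuous_intros) auto
  moreover have "ereal (g a) \<le> circle_mean (\<lambda>z. ereal (g z)) a b" for a b
  proof -
    obtain P where P: "\<And>\<zeta>. p (a + \<zeta> *s b) = poly P \<zeta>"
      using complex_polynomial_on_line[OF p] by metis
    have P0: "p a = poly P 0" using P[of 0] by simp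
    have cl: "continuous_on {0..2 * pi} (\<lambda>t. ln (1 + (norm (poly P (cis t)))\<^sup>2))"
      using pos by (intro continuous_intros) auto
    have "continuous_on {0..2 * pi} (\<lambda>t. g (a + cis t *s b))"
      unfolding g_def P by (intro continuous_intros cl)
    moreover have "2 * pi * g a \<le> integral {0..2 * pi} (\<lambda>t. g (a + cis t *s b))"
    proof -
      have "integral {0..2 * pi} (\<lambda>t. g (a + cis t *s b)) =
          m * (integral {0..2 * pi} (\<lambda>t. ln (1 + (norm (poly P (cis t)))\<^sup>2)) - 2 * pi * C)"
        unfolding g_def P using cl
        by (simp add: integral_diff integrable_continuous_real)
      moreover have "m * (2 * pi * ln (1 + (norm (poly P 0))\<^sup>2) - 2 * pi * C) \<le> \<dots>"
        using log_one_plus_poly_square_le_circle_integral[of P] m by (intro mult_left_mono) auto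
      ultimately show ?thesis by (simp add: g_def P0 algebra_simps)
    qed
    ultimately show ?thesis by (subst circle_mean_continuous) (auto simp: field_simps)
  qed
  ultimately have "plurisubharmonic (\<lambda>z. ereal (g z))"
    unfolding plurisubharmonic_def upper_semicontinuous_def by auto
  then show ?thesis by (simp only: g_def)
qed

lemma le_usc_regularization: "f z \<le> usc_regularization f z"
  unfolding usc_regularization_def Limsup_def
  by (rule INF_greatest) (auto intro!: SUP_upper dest: eventually_nhds_x_imp_x)

lemma green_competitor_le_green: "v \<in> green_competitors A \<Longrightarrow> v z \<le> green A z"
  unfolding green_def by (rule order_trans[OF _ le_usc_regularization]) (rule SUP_upper)

text \<open>
  If \<open>\<bar>p\<bar> \<le> M\<close> on \<open>A\<close> and \<open>\<bar>p z\<bar> > M\<close>, then \<open>(ln (1 + \<bar>p\<bar>\<^sup>2) - ln (1 + M\<^sup>2)) / (2 d)\<close> is a competitor for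
  large \<open>d\<close>, and it is positive at \<open>z\<close>.
\<close>

lemma green_pos_outside_polynomial_hull:
  fixes A :: "(complex ^ 'n::finite) set"
  assumes "A \<noteq> {}" "z \<notin> polynomial_hull A"
  shows "green A z > 0"
proof -
  obtain p where p: "complex_polynomial p" and "(SUP w\<in>A. ereal (norm (p w))) < ereal (norm (p z))"
    using assms(2) by (auto simp: polynomial_hull_def not_le)
  then obtain M where M: "(SUP w\<in>A. ereal (norm (p w))) < ereal M" "M < norm (p z)"
    using ereal_dense2 by fastforce
  have le: "norm (p w) \<le> M" if "w \<in> A" for w
    using order.strict_trans1[OF SUP_upper[OF that] M(1)] by simp
  have M0: "M \<ge> 0" using assms(1) le norm_ge_zero order_trans by (metis ex_in_conv)
  obtain C d where C: "d > 0" "C > 0" "\<And>z. 1 + (norm (p z))\<^sup>2 \<le> C * (1 + (norm z)\<^sup>2) ^ d"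
    using complex_polynomial_growth[OF p] by metis
  have pos: "1 + x\<^sup>2 > 0" for x :: real by (simp add: add_pos_nonneg)
  define g where "g = (\<lambda>z. 1 / (2 * real d) * (ln (1 + (norm (p z))\<^sup>2) - ln (1 + M\<^sup>2)))"
  have "(\<lambda>z. ereal (g z)) \<in> green_competitors A"
    unfolding green_competitors_def
  proof (intro CollectI conjI ballI exI allI)
    show "plurisubharmonic (\<lambda>z. ereal (g z))"
      unfolding g_def by (rule plurisubharmonic_log_one_plus_square[OF p]) simp
    show "ereal (g w) \<le> 0" if "w \<in> A" for w
    proof -
      have "(norm (p w))\<^sup>2 \<le> M\<^sup>2" using le[OF that] by (intro power_mono) auto
      then have "ln (1 + (norm (p w))\<^sup>2) \<le> ln (1 + M\<^sup>2)" using pos by (subst ln_le_cancel_iff) auto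
      then show ?thesis by (simp add: g_def mult_nonneg_nonpos zero_ereal_def divide_nonpos_nonneg)
    qed
    show "ereal (g w) \<le> ereal (1 / 2 * ln (1 + (norm w)\<^sup>2) + 1 / (2 * real d) * (ln C - ln (1 + M\<^sup>2)))" for w
    proof -
      have "ln (1 + (norm (p w))\<^sup>2) \<le> ln (C * (1 + (norm w)\<^sup>2) ^ d)"
        using C pos by (intro ln_mono) auto
      also have "\<dots> = ln C + d * ln (1 + (norm w)\<^sup>2)"
        using C pos[of "norm w"] by (simp add: ln_mult ln_realpow)
      finally have "g w \<le> 1 / (2 * real d) * (ln C + d * ln (1 + (norm w)\<^sup>2) - ln (1 + M\<^sup>2))"
        unfolding g_def by (intro mult_left_mono) auto
      also have "\<dots> = 1 / 2 * ln (1 + (norm w)\<^sup>2) + 1 / (2 * real d) * (ln C - ln (1 + M\<^sup>2))"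
        using C(1) by (simp add: field_simps)
      finally show ?thesis by simp
    qed
  qed
  then have "ereal (g z) \<le> green A z" by (rule green_competitor_le_green)
  moreover have "g z > 0"
  proof -
    have "M\<^sup>2 < (norm (p z))\<^sup>2" using M(2) M0 by (intro power_strict_mono) auto
    then have "ln (1 + M\<^sup>2) < ln (1 + (norm (p z))\<^sup>2)" using pos by (subst ln_less_cancel_iff) auto
    then show ?thesis using C(1) by (simp add: g_def)
  qed
  ultimately show ?thesis by (metis ereal_less(2) order_less_le_trans)
qed

section \<open>Boundary points of a compact set\<close>

theorem proposition1:
  fixes A :: "(complex ^ 'n::finite) set"
  assumes "compact A"
    and "\<not> pluripolar A"
    and "L_regular A"
    and "polynomially_convex A"
    and "pluriharmonic_on (- A) (\<lambda>z. real_of_ereal (green A z))"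
  shows "\<exists>c0::real. c0 > 0 \<and> (\<forall>c::real. 0 < c \<and> c \<le> c0 \<longrightarrow>
           frontier A \<subseteq> frontier {z. green A z > ereal (c * infdist z A powr (1 / c))})"
proof -
  define \<theta> where "\<theta> = 1 + 2 * CARD('n) * exp (3 * (12 * CARD('n) + 14))"
  have \<theta>: "\<theta> \<ge> 1" by (simp add: \<theta>_def)
  \<comment> \<open>The constant \<open>\<theta>\<close> depends only on \<open>n\<close>, and so does \<open>c\<^sub>0\<close>.\<close>
  obtain m where m: "(3/4::real) ^ m < 1 / (\<theta> + 1)"
    using real_arch_pow_inv[of "1 / (\<theta> + 1)" "3/4"] \<theta> by auto
  define c0 where "c0 = 1 / real (Suc m)"
  show ?thesis
  proof (intro exI[of _ c0] conjI allI impI subsetI)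
    show "c0 > 0" by (simp add: c0_def)
    fix c :: real and a assume c: "0 < c \<and> c \<le> c0" and a: "a \<in> frontier A"
    have small: "\<theta> * (3/4) powr (1/c) < 1"
    proof -
      have "1 / c \<ge> 1 / c0" using c by (intro divide_left_mono) (auto simp: c0_def)
      then have "real m \<le> 1 / c" by (simp add: c0_def)
      then have "(3/4::real) powr (1/c) \<le> (3/4) powr real m" by (intro powr_mono') auto
      also have "\<dots> < 1 / (\<theta> + 1)" using m by (simp add: powr_realpow)
      finally have "(3/4) powr (1/c) * (\<theta> + 1) < 1" using \<theta> by (simp add: field_simps)
      then have "\<theta> * (3/4) powr (1/c) + (3/4) powr (1/c) < 1" by (simp add: algebra_simps)
      moreover have "(0::real) \<le> (3/4) powr (1/c)" by simp
      ultimately show ?thesis by linarith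
    qed
    define W where "W = {z. green A z > ereal (c * infdist z A powr (1 / c))}"
    have cl: "closed A" using assms(1) by (rule compact_imp_closed)
    have aA: "a \<in> A" using a cl by (simp add: frontier_def)
    have gpos: "green A z > 0" if "z \<notin> A" for z
      using that assms(4) aA green_pos_outside_polynomial_hull[of A z] by (auto simp: polynomially_convex_def)
    have "a \<notin> W" using aA assms(3) c by (simp add: W_def L_regular_def)
    moreover have "a \<in> closure W"
    proof (rule ccontr)
      assume "a \<notin> closure W"
      then obtain r where r: "r > 0" "ball a r \<inter> W = {}"
        using open_contains_ball[of "- closure W"] closure_subset[of W] by blast
      obtain p where p: "p \<notin> A" "dist p a < r / 4"
      proof -
        have "a \<in> closure (- A)" using a by (simp add: frontier_closures)
        then show ?thesis using r(1) that unfolding closure_approachable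
          by (auto dest!: spec[of _ "r / 4"])
      qed
      obtain q where q: "q \<in> A" "infdist p A = dist p q"
        using infdist_attains_inf[OF cl, of p] aA by auto
      have "dist p q \<le> dist p a" using infdist_le[OF aA, of p] q by simp
      then have near: "dist a y < r" if "y \<in> ball p (dist p q)" for y
        using that p(2) dist_triangle[of a y p] r(1) by (auto simp: dist_commute)
      have off: "y \<notin> A" if "y \<in> ball p (dist p q)" for y
        using that infdist_le[of y A p] q(2) by auto
      have le: "green A y \<le> ereal (c * infdist y A powr (1 / c))" if "y \<in> ball p (dist p q)" for y
        using near[OF that] r(2) by (auto simp: W_def disjoint_iff not_less)
      have "\<exists>y\<in>ball p (dist p q). c * dist y q powr (1/c) < real_of_ereal (green A y)"
      proof (rule pluriharmonic_not_flat_at_boundary_point[OF assms(5)])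
        show "ball p (dist p q) \<subseteq> - A" using off by auto
        show "p \<noteq> q" using p(1) q(1) by auto
        \<comment> \<open>The assumed upper bound makes the Green function finite here, so its real value keeps the sign.\<close>
        show "0 < real_of_ereal (green A y)" if "y \<in> ball p (dist p q)" for y
          using le[OF that] gpos[OF off[OF that]] by (cases "green A y") auto
      qed (use c small in \<open>auto simp: \<theta>_def\<close>)
      then obtain y where y: "y \<in> ball p (dist p q)" "c * dist y q powr (1/c) < real_of_ereal (green A y)"
        by blast
      have "real_of_ereal (green A y) \<le> c * infdist y A powr (1 / c)"
        using le[OF y(1)] gpos[OF off[OF y(1)]] by (cases "green A y") auto
      also have "\<dots> \<le> c * dist y q powr (1 / c)"
        using c infdist_le[OF q(1), of y] by (intro mult_left_mono powr_mono2) (auto simp: infdist_nonneg)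
      finally show False using y(2) by simp
    qed
    ultimately show "a \<in> frontier {z. green A z > ereal (c * infdist z A powr (1 / c))}"
      unfolding W_def[symmetric] frontier_def using interior_subset by blast
  qed
qed

end
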